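(* Let $0<p\le1/2$, $s\in[1/2,1]$, $\epsilon_1>0$, and for each $m$ let $n=n(m)\ge(1+\epsilon_1)\,m\log(1/p)$. Let the number of users be $M=\lfloor 2^{H(s)m-1}\rfloor$ (read as $1$ if this is $0$), let the key of the strongly universal set of hash functions $H_{g(\underline k)}(i)=k_i$ be drawn i.i.d. Bernoulli$(p)$, and let the users be allocated the $M$ least likely bins. Then $$ \lim_{m\to\infty}\frac1m\log E(G_{remote}(B))=\begin{cases}H(s)+D(s\|p), & 1-p\le s\le 1,\\ 2H(p)+D(1-p\|p)-H(s), & 1/2\le s\le 1-p.\end{cases} $$
   Context: Logarithms are base 2. $H(q)=-q\log q-(1-q)\log(1-q)$ and $D(q\|p)=q\log\frac qp+(1-q)\log\frac{1-q}{1-p}$ (with $0\log 0=0$). The key $\underline k=(k_1,\dots,k_{2^n})$ consists of $2^n$ segments of $m$ bits, and the hash function with this key maps input $i\in\{1,\dots,2^n\}$ to the bin $H_{g(\underline k)}(i)=k_i\in\{0,1\}^m\cong\{1,\dots,2^m\}$. All $m2^n$ key bits are i.i.d. Bernoulli$(p)$ (probability $p$ of a one); $P_K(b)$ denotes the probability of $b\in\{0,1\}^m$ under i.i.d. Bernoulli$(p)$ bits. The bins are ordered $b_1,b_2,\dots,b_{2^m}$ from least likely (the all-ones bin) upward with respect to $P_K$, and user $i$ is allocated the bin $b_i$, $1\le i\le M$. The attacker, not knowing the key, guesses inputs one by one (in any fixed order, without repetition). $G_{bin}(b)$ is the number of guesses up to and including the first input mapped to $b$; it is set to $0$ if no input is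 mapped to $b$. The average guesswork under a remote attack is $E(G_{remote}(B))=\frac1M\sum_{i=1}^{M}E(G_{bin}(b_i))$, with expectation over the key. *)

theory Defs
  imports "HOL-Probability.Probability"
begin

text \<open>Logarithms are base 2. Since \<^term>\<open>log 2 0 = 0\<close> here, the convention
  \<open>0 log 0 = 0\<close> holds automatically.\<close>

definition bin_entropy :: "real \<Rightarrow> real" where
  "bin_entropy q = - q * log 2 q - (1 - q) * log 2 (1 - q)"

definition bin_divergence :: "real \<Rightarrow> real \<Rightarrow> real" where
  "bin_divergence q p = q * log 2 (q / p) + (1 - q) * log 2 ((1 - q) / (1 - p))"

text \<open>Bins are bit strings of length \<open>m\<close>, represented as lists (\<^term>\<open>True\<close> is a one).\<close>

definition bins :: "nat \<Rightarrow> bool list set" where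
  "bins m = {b. length b = m}"

text \<open>A key assigns to \<open>(i, j)\<close> the \<open>j\<close>-th bit of its \<open>i\<close>-th segment,
  \<open>1 \<le> i \<le> 2^n\<close>, \<open>1 \<le> j \<le> m\<close>; positions outside this range are constantly
  \<^term>\<open>False\<close> and never read.\<close>

type_synonym key = "nat \<times> nat \<Rightarrow> bool"

definition key_pmf :: "real \<Rightarrow> nat \<Rightarrow> nat \<Rightarrow> key pmf" where
  "key_pmf p n m = Pi_pmf ({1..2 ^ n} \<times> {1..m}) False (\<lambda>_. bernoulli_pmf p)"

definition hash :: "nat \<Rightarrow> key \<Rightarrow> nat \<Rightarrow> bool list" where
  "hash m k i = map (\<lambda>j. k (i, j)) [1..<Suc m]"

definition P_K :: "real \<Rightarrow> nat \<Rightarrow> bool list \<Rightarrow> real" where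
  "P_K p m b = pmf (replicate_pmf m (bernoulli_pmf p)) b"

text \<open>\<open>b 1, \<dots>, b (2^m)\<close> lists all bins from least to most likely; ties are broken arbitrarily.\<close>

definition likelihood_ordering :: "real \<Rightarrow> nat \<Rightarrow> (nat \<Rightarrow> bool list) \<Rightarrow> bool" where
  "likelihood_ordering p m b \<longleftrightarrow>
     bij_betw b {1..2 ^ m} (bins m) \<and>
     (\<forall>i\<in>{1..2 ^ m}. \<forall>j\<in>{1..2 ^ m}. i \<le> j \<longrightarrow> P_K p m (b i) \<le> P_K p m (b j))"

text \<open>The \<open>j\<close>-th guessed input is \<open>g j\<close>.\<close>

definition guess_order :: "nat \<Rightarrow> (nat \<Rightarrow> nat) \<Rightarrow> bool" where
  "guess_order n g \<longleftrightarrow> bij_betw g {1..2 ^ n} {1..2 ^ n}"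

definition G_bin :: "nat \<Rightarrow> nat \<Rightarrow> (nat \<Rightarrow> nat) \<Rightarrow> key \<Rightarrow> bool list \<Rightarrow> nat" where
  "G_bin n m g k b =
     (if \<exists>j\<in>{1..2 ^ n}. hash m k (g j) = b
      then LEAST j. j \<in> {1..2 ^ n} \<and> hash m k (g j) = b
      else 0)"

definition num_users :: "real \<Rightarrow> nat \<Rightarrow> nat" where
  "num_users s m = max 1 (nat \<lfloor>2 powr (bin_entropy s * real m - 1)\<rfloor>)"

definition remote_guesswork ::
    "real \<Rightarrow> nat \<Rightarrow> nat \<Rightarrow> (nat \<Rightarrow> nat) \<Rightarrow> (nat \<Rightarrow> bool list) \<Rightarrow> nat \<Rightarrow> real" where
  "remote_guesswork p n m g b M =
     (\<Sum>i = 1..M. measure_pmf.expectation (key_pmf p n m) (\<lambda>k. real (G_bin n m g k (b i)))) / real M"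

end

theory Submission
  imports Defs
begin

text \<open>Since the keys are long, \<open>q 2\<^sup>n \<rightarrow> \<infinity>\<close> for every bin likelihood \<open>q \<ge> p\<^sup>m\<close>, so the truncated
  geometric expectation of the guesswork of a bin lies between \<open>1 / (2 q)\<close> and \<open>1 / q\<close>. It remains to
  average \<open>1 / q\<close> over the \<open>M\<close> bins with the most ones. About \<open>2\<^bsup>H(x) m\<^esup>\<close> bins have \<open>x m\<close> ones,
  each contributing \<open>2\<^bsup>m (H(x) + D(x \<parallel> p))\<^esup>\<close>, and the exponent \<open>2 H(x) + D(x \<parallel> p)\<close> of the total
  is largest at \<open>x = 1 - p\<close>. If \<open>s \<ge> 1 - p\<close> this point is not among the allocated bins and the
  boundary \<open>x = s\<close> dominates; otherwise the sum has the same exponent as the sum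
  \<open>(p (1 - p))\<^bsup>-m\<^esup>\<close> over all bins.\<close>

section \<open>Guesswork of a single bin\<close>

lemma pmf_replicate_pmf:
  "length xs = m \<Longrightarrow> pmf (replicate_pmf m M) xs = (\<Prod>j<m. pmf M (xs ! j))"
proof (induction m arbitrary: xs)
  case (Suc m)
  then obtain y ys where xs: "xs = y # ys" "length ys = m"
    by (auto simp: length_Suc_conv)
  have "replicate_pmf (Suc m) M = map_pmf (\<lambda>(x, xs). x # xs) (pair_pmf M (replicate_pmf m M))"
    by (simp add: pair_pmf_def map_bind_pmf)
  also have "pmf \<dots> xs = pmf (pair_pmf M (replicate_pmf m M)) (y, ys)"
    using pmf_map_inj'[of "\<lambda>(x, xs). x # xs" _ "(y, ys)"] by (simp add: xs inj_on_def)
  also have "\<dots> = (\<Prod>j<Suc m. pmf M (xs ! j))"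
    using Suc.IH[OF xs(2)] by (subst prod.lessThan_Suc_shift) (simp add: pmf_pair xs)
  finally show ?case .
qed simp

abbreviation ones :: "bool list \<Rightarrow> nat" where
  "ones b \<equiv> count_list b True"

lemma ones_le: "b \<in> bins m \<Longrightarrow> ones b \<le> m"
  using count_le_length by (auto simp: bins_def)

lemma P_K_eq:
  assumes "b \<in> bins m" "0 \<le> p" "p \<le> 1"
  shows "P_K p m b = p ^ ones b * (1 - p) ^ (m - ones b)"
proof -
  have "(\<Prod>j<length b. pmf (bernoulli_pmf p) (b ! j)) = p ^ ones b * (1 - p) ^ (length b - ones b)"
  proof (induction b)
    case (Cons x b)
    have "Suc (length b) - ones b = Suc (length b - ones b)"
      by (rule Suc_diff_le[OF count_le_length])
    then show ?case
      using Cons assms by (auto simp: prod.lessThan_Suc_shift simp del: prod.lessThan_Suc)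
  qed simp
  then show ?thesis
    using assms by (simp add: P_K_def pmf_replicate_pmf bins_def)
qed

lemma prob_hash_eq:
  assumes "c \<in> bins m"
  shows "measure_pmf.prob (Pi_pmf ({i} \<times> {1..m}) False (\<lambda>_. bernoulli_pmf p)) {k. hash m k i = c}
    = P_K p m c"
proof -
  have len: "length c = m" using assms by (simp add: bins_def)
  \<comment> \<open>Key bits are numbered from 1 and list entries from 0, hence the index
    \<open>j - 1\<close>. As a product of one-bit conditions the event has a product
    probability.\<close>
  have "{k. hash m k i = c} = Pi ({i} \<times> {1..m}) (\<lambda>(i, j). {c ! (j - 1)})"
  proof (intro set_eqI iffI)
    fix k assume "k \<in> {k. hash m k i = c}"
    then show "k \<in> Pi ({i} \<times> {1..m}) (\<lambda>(i, j). {c ! (j - 1)})"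
      by (auto simp: hash_def simp del: upt_Suc)
  next
    fix k assume k: "k \<in> Pi ({i} \<times> {1..m}) (\<lambda>(i, j). {c ! (j - 1)})"
    have "hash m k i = c"
    proof (rule nth_equalityI)
      fix j assume "j < length (hash m k i)"
      then have "j < m" by (simp add: hash_def del: upt_Suc)
      then show "hash m k i ! j = c ! j"
        using Pi_mem[OF k, of "(i, Suc j)"] by (simp add: hash_def del: upt_Suc)
    qed (simp add: hash_def len del: upt_Suc)
    then show "k \<in> {k. hash m k i = c}" by simp
  qed
  then have "measure_pmf.prob (Pi_pmf ({i} \<times> {1..m}) False (\<lambda>_. bernoulli_pmf p)) {k. hash m k i = c}
    = (\<Prod>x\<in>{i} \<times> {1..m}. pmf (bernoulli_pmf p) (c ! (snd x - 1)))"
    by (simp add: measure_Pi_pmf_Pi case_prod_unfold measure_pmf_single)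
  also have "\<dots> = (\<Prod>j<m. pmf (bernoulli_pmf p) (c ! j))"
    by (rule prod.reindex_bij_witness[where i = "\<lambda>j. (i, Suc j)" and j = "\<lambda>x. snd x - 1"]) auto
  finally show ?thesis
    by (simp add: P_K_def pmf_replicate_pmf len)
qed

lemma hash_cong: "(\<And>j. j \<in> {1..m} \<Longrightarrow> k (i, j) = k' (i, j)) \<Longrightarrow> hash m k i = hash m k' i"
  by (auto simp: hash_def)

text \<open>Distinct inputs read disjoint blocks of independent bits. The induction splits off the
  block of one input, which contributes one factor \<open>1 - P_K p m c\<close>.\<close>

lemma prob_no_hit_Pi:
  assumes "finite J" "c \<in> bins m"
  shows "measure_pmf.prob (Pi_pmf (J \<times> {1..m}) False (\<lambda>_. bernoulli_pmf p))
    {k. \<forall>i\<in>J. hash m k i \<noteq> c} = (1 - P_K p m c) ^ card J"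
  using assms(1)
proof induction
  case (insert i J)
  define Q where "Q = (\<lambda>A :: nat set. Pi_pmf (A \<times> {1..m}) False (\<lambda>_. bernoulli_pmf p))"
  define h where "h = (\<lambda>(f :: key) g x. if x \<in> {i} \<times> {1..m} then f x else g x)"
  have "insert i J \<times> {1..m} = {i} \<times> {1..m} \<union> J \<times> {1..m}" by auto
  then have eq: "Q (insert i J) = map_pmf (\<lambda>(f, g). h f g) (pair_pmf (Q {i}) (Q J))"
    unfolding Q_def h_def using insert by (simp only:, intro Pi_pmf_union) auto
  have "hash m (h f g) i = hash m f i" for f g
    unfolding h_def by (rule hash_cong) auto
  moreover have "hash m (h f g) i' = hash m g i'" if "i' \<in> J" for f g i'
    unfolding h_def using that insert by (intro hash_cong) auto
  ultimately have vimage: "(\<lambda>(f, g). h f g) -` {k. \<forall>i\<in>insert i J. hash m k i \<noteq> c}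
    = {f. hash m f i \<noteq> c} \<times> {g. \<forall>i\<in>J. hash m g i \<noteq> c}"
    by auto
  have compl: "measure_pmf.prob (Q {i}) {f. hash m f i \<noteq> c} = 1 - P_K p m c"
    using measure_pmf.prob_compl[of "{f. hash m f i = c}" "Q {i}"]
    unfolding Q_def prob_hash_eq[OF assms(2)] by (simp add: Collect_neg_eq Compl_eq_Diff_UNIV)
  have "measure_pmf.prob (Q (insert i J)) {k. \<forall>i\<in>insert i J. hash m k i \<noteq> c}
    = measure_pmf.prob (pair_pmf (Q {i}) (Q J))
        ({f. hash m f i \<noteq> c} \<times> {g. \<forall>i\<in>J. hash m g i \<noteq> c})"
    unfolding eq by (simp only: measure_map_pmf vimage)
  also have "\<dots> = measure_pmf.prob (Q {i}) {f. hash m f i \<noteq> c} *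
      measure_pmf.prob (Q J) {g. \<forall>i\<in>J. hash m g i \<noteq> c}"
  \<comment> \<open>The product rule is applied to countable sets, but sets of keys may be
    uncountable. Intersecting with the countable supports changes no probability.\<close>
  proof -
    let ?A = "{f. hash m f i \<noteq> c}" and ?B = "{g. \<forall>i\<in>J. hash m g i \<noteq> c}"
    have "measure_pmf.prob (pair_pmf (Q {i}) (Q J)) (?A \<times> ?B)
      = measure_pmf.prob (pair_pmf (Q {i}) (Q J)) ((?A \<inter> set_pmf (Q {i})) \<times> (?B \<inter> set_pmf (Q J)))"
      by (subst measure_Int_set_pmf[symmetric]) (simp add: Times_Int_Times)
    also have "\<dots> = measure_pmf.prob (Q {i}) (?A \<inter> set_pmf (Q {i})) *
        measure_pmf.prob (Q J) (?B \<inter> set_pmf (Q J))"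
      by (rule measure_pmf_prob_product) (auto intro: countable_Int2)
    finally show ?thesis by (simp add: measure_Int_set_pmf)
  qed
  finally show ?case
    using insert by (simp add: compl) (simp add: Q_def)
qed simp

text \<open>The event reads only the segments in \<open>J\<close>, and resetting all other bits to
  \<open>False\<close> maps the key distribution to the product distribution over these
  segments.\<close>

lemma prob_no_hit:
  assumes "J \<subseteq> {1..2 ^ n}" "c \<in> bins m"
  shows "measure_pmf.prob (key_pmf p n m) {k. \<forall>i\<in>J. hash m k i \<noteq> c} = (1 - P_K p m c) ^ card J"
proof -
  let ?r = "\<lambda>(f :: key) x. if x \<in> J \<times> {1..m} then f x else False"
  have "hash m (?r f) i = hash m f i" if "i \<in> J" for f i
    using that by (intro hash_cong) auto
  then have "?r -` {k. \<forall>i\<in>J. hash m k i \<noteq> c} = {k. \<forall>i\<in>J. hash m k i \<noteq> c}"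
    by auto
  moreover have "Pi_pmf (J \<times> {1..m}) False (\<lambda>_. bernoulli_pmf p) = map_pmf ?r (key_pmf p n m)"
    unfolding key_pmf_def using assms(1) by (intro Pi_pmf_subset) auto
  ultimately show ?thesis
    using prob_no_hit_Pi[OF finite_subset[OF assms(1)] assms(2), of p] by simp
qed

section \<open>The first hit and its expectation\<close>

text \<open>If some guess hits, the first hit position is the number of \<open>j\<close> for which
  the guesses before \<open>j\<close> all miss, and the subtracted indicator vanishes. If none hits,
  both indicators are 1 in every summand, which produces the default value 0.\<close>

lemma G_bin_eq_sum:
  "real (G_bin n m g k c) =
    (\<Sum>j = 1..2 ^ n. indicator {k. \<forall>i\<in>{1..<j}. hash m k (g i) \<noteq> c} k
      - indicator {k. \<forall>i\<in>{1..2 ^ n}. hash m k (g i) \<noteq> c} k)"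
proof (cases "\<exists>j\<in>{1..2 ^ n}. hash m k (g j) = c")
  case False
  then show ?thesis by (auto simp: G_bin_def)
next
  case True
  define l where "l = (LEAST j. j \<in> {1..2 ^ n} \<and> hash m k (g j) = c)"
  have l: "l \<in> {1..2 ^ n}" "hash m k (g l) = c"
    using LeastI_ex[of "\<lambda>j. j \<in> {1..2 ^ n} \<and> hash m k (g j) = c"] True unfolding l_def by blast+
  have least: "l \<le> j" if "j \<in> {1..2 ^ n}" "hash m k (g j) = c" for j
    unfolding l_def using that by (intro Least_le) auto
  have "real (G_bin n m g k c) = real (card {1..l})"
    using True by (simp add: G_bin_def l_def)
  also have "{1..l} = {j \<in> {1..2 ^ n}. \<forall>i\<in>{1..<j}. hash m k (g i) \<noteq> c}"
  proof (intro set_eqI iffI)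
    fix j assume "j \<in> {1..l}"
    then have j: "1 \<le> j" "j \<le> l" by auto
    then have "hash m k (g i) \<noteq> c" if "i \<in> {1..<j}" for i
      using least[of i] l(1) that by auto
    then show "j \<in> {j \<in> {1..2 ^ n}. \<forall>i\<in>{1..<j}. hash m k (g i) \<noteq> c}"
      using j l(1) by auto
  next
    fix j assume "j \<in> {j \<in> {1..2 ^ n}. \<forall>i\<in>{1..<j}. hash m k (g i) \<noteq> c}"
    then have j: "1 \<le> j" "l \<notin> {1..<j}" using l(2) by auto
    then show "j \<in> {1..l}" using l(1) by auto
  qed
  also have "real (card \<dots>) = (\<Sum>j = 1..2 ^ n. indicator {k. \<forall>i\<in>{1..<j}. hash m k (g i) \<noteq> c} k)"
    by (simp add: indicator_def sum.If_cases Int_def)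
  finally show ?thesis using True by (simp add: sum_subtractf)
qed

text \<open>Since \<open>g\<close> is injective, the first \<open>j - 1\<close> guesses are distinct
  inputs and all miss with probability \<open>(1 - q)^(j - 1)\<close>, where \<open>q\<close> is the
  likelihood of the bin. The last term is the correction for keys that never hit.\<close>

lemma expectation_G_bin:
  assumes "guess_order n g" "c \<in> bins m"
  shows "measure_pmf.expectation (key_pmf p n m) (\<lambda>k. real (G_bin n m g k c))
    = (\<Sum>j<2 ^ n. (1 - P_K p m c) ^ j) - 2 ^ n * (1 - P_K p m c) ^ 2 ^ n"
proof -
  have prob: "measure_pmf.prob (key_pmf p n m) {k. \<forall>i\<in>I. hash m k (g i) \<noteq> c}
      = (1 - P_K p m c) ^ card I" if "I \<subseteq> {1..2 ^ n}" for I
  proof -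
    have "g ` I \<subseteq> {1..2 ^ n}" "inj_on g I"
      using assms(1) that unfolding guess_order_def bij_betw_def
      by (blast, metis inj_on_subset)
    then show ?thesis
      using prob_no_hit[of "g ` I" n c m p] assms(2) by (simp add: card_image)
  qed
  have "measure_pmf.expectation (key_pmf p n m) (\<lambda>k. real (G_bin n m g k c))
    = (\<Sum>j = 1..2 ^ n. measure_pmf.prob (key_pmf p n m) {k. \<forall>i\<in>{1..<j}. hash m k (g i) \<noteq> c}
       - measure_pmf.prob (key_pmf p n m) {k. \<forall>i\<in>{1..2 ^ n}. hash m k (g i) \<noteq> c})"
    unfolding G_bin_eq_sum
    by (subst Bochner_Integration.integral_sum)
       (auto simp: Bochner_Integration.integral_diff measure_pmf.integrable_const_bound[where B = 1]
         intro!: sum.cong Bochner_Integration.integrable_diff measure_pmf.integrable_const_bound[where B = 1])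
  also have "\<dots> = (\<Sum>j = 1..2 ^ n. (1 - P_K p m c) ^ (j - 1) - (1 - P_K p m c) ^ 2 ^ n)"
    by (intro sum.cong refl) (subst prob, force, simp)+
  also have "\<dots> = (\<Sum>j = 1..2 ^ n. (1 - P_K p m c) ^ (j - 1)) - 2 ^ n * (1 - P_K p m c) ^ 2 ^ n"
    by (simp add: sum_subtractf)
  also have "(\<Sum>j = 1..2 ^ n. (1 - P_K p m c) ^ (j - 1)) = (\<Sum>j<2 ^ n. (1 - P_K p m c) ^ j)"
    by (rule sum.reindex_bij_witness[where i = Suc and j = "\<lambda>j. j - 1"]) auto
  finally show ?thesis .
qed

text \<open>The truncated geometric series is at most \<open>1 / q\<close>, and the correction term
  only lowers the expectation.\<close>

lemma expectation_G_bin_le: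
  assumes "guess_order n g" "c \<in> bins m" "0 < P_K p m c"
  shows "measure_pmf.expectation (key_pmf p n m) (\<lambda>k. real (G_bin n m g k c)) \<le> 1 / P_K p m c"
proof -
  have "P_K p m c \<le> 1" by (simp add: P_K_def pmf_le_1)
  then show ?thesis
    unfolding expectation_G_bin[OF assms(1,2)] using assms(3)
    by (subst sum_gp_strict) (auto simp: field_simps add_increasing)
qed

text \<open>With \<open>x = 2^n q\<close>, the expectation equals
  \<open>(1 - (1 - q)^(2^n) (1 + x)) / q\<close>. Since \<open>(1 - q)^(2^n)\<close> is at most
  \<open>exp (- x)\<close>, it suffices that \<open>(1 + x) exp (- x)\<close> is at most
  1/2.\<close>

lemma expectation_G_bin_ge:
  assumes "guess_order n g" "c \<in> bins m" "0 < P_K p m c" "3 \<le> 2 ^ n * P_K p m c"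
  shows "1 / (2 * P_K p m c) \<le> measure_pmf.expectation (key_pmf p n m) (\<lambda>k. real (G_bin n m g k c))"
proof -
  define q where "q = P_K p m c"
  define x where "x = 2 ^ n * q"
  have q: "0 < q" "q \<le> 1" using assms(3) by (simp_all add: q_def P_K_def pmf_le_1)
  have x: "3 \<le> x" using assms(4) by (simp add: x_def q_def)
  have "(1 - q) ^ 2 ^ n \<le> exp (- q) ^ 2 ^ n"
    using exp_ge_add_one_self[of "- q"] q by (intro power_mono) auto
  also have "\<dots> = 1 / exp x"
    using exp_of_nat_mult[of "2 ^ n" "- q"] by (simp add: x_def exp_minus inverse_eq_divide)
  finally have "(1 - q) ^ 2 ^ n * (1 + x) \<le> 1 / exp x * (1 + x)"
    using x by (intro mult_right_mono) auto
  also have "\<dots> \<le> 1 / 2"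
  proof -
    \<comment> \<open>This is where the threshold 3 enters: the quadratic Taylor polynomial of
      \<open>exp\<close> is at least \<open>2 * (1 + x)\<close> from there on.\<close>
    have "0 \<le> (x - 3) * (x + 1)" using x by simp
    then have "2 * (1 + x) \<le> 1 + x + x\<^sup>2 / 2"
      by (simp add: power2_eq_square algebra_simps)
    also have "\<dots> \<le> exp x" using x by (intro exp_lower_Taylor_quadratic) auto
    finally show ?thesis by (simp add: field_simps)
  qed
  finally have "1 / 2 \<le> 1 - (1 - q) ^ 2 ^ n * (1 + x)" by simp
  then have "1 / 2 / q \<le> (1 - (1 - q) ^ 2 ^ n * (1 + x)) / q"
    using q by (intro divide_right_mono) auto
  also have "\<dots> = (\<Sum>j<2 ^ n. (1 - q) ^ j) - 2 ^ n * (1 - q) ^ 2 ^ n"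
    using q by (subst sum_gp_strict) (auto simp: x_def field_simps)
  finally show ?thesis
    unfolding expectation_G_bin[OF assms(1,2)] q_def by simp
qed

section \<open>Cross entropy\<close>

text \<open>The exponent per bit: a string with \<open>x m\<close> ones has probability
  \<open>2^(-m cross_entropy x q)\<close> under Bernoulli(q) bits. Unlike
  \<open>H(x) + D(x || q)\<close>, this form is visibly affine in \<open>x\<close>.\<close>

definition cross_entropy :: "real \<Rightarrow> real \<Rightarrow> real" where
  "cross_entropy x q = - x * log 2 q - (1 - x) * log 2 (1 - q)"

lemma cross_entropy_self: "cross_entropy q q = bin_entropy q"
  by (simp add: cross_entropy_def bin_entropy_def)

lemma cross_entropy_eq_entropy_divergence:
  assumes "0 \<le> x" "x \<le> 1" "0 < q" "q < 1"
  shows "cross_entropy x q = bin_entropy x + bin_divergence x q"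
proof -
  have "y * log 2 (y / z) = y * log 2 y - y * log 2 z" if "0 \<le> y" "0 < z" for y z :: real
    using that by (cases "y = 0") (auto simp: log_divide algebra_simps)
  from this[of x q] this[of "1 - x" "1 - q"] show ?thesis
    using assms by (simp add: cross_entropy_def bin_entropy_def bin_divergence_def)
qed

text \<open>Gibbs' inequality: \<open>ln t \<le> t - 1\<close> is applied to both outcomes, and the
  two right-hand sides add up to 0.\<close>

lemma bin_entropy_le_cross_entropy:
  assumes "0 \<le> x" "x \<le> 1" "0 < q" "q < 1"
  shows "bin_entropy x \<le> cross_entropy x q"
proof -
  have gibbs: "y * (log 2 z - log 2 y) * ln 2 \<le> z - y" if "0 \<le> y" "0 < z" for y z :: real
  proof (cases "y = 0")
    case False
    then have "y * (ln z - ln y) \<le> y * (z / y - 1)"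
      using that ln_le_minus_one[of "z / y"] by (intro mult_left_mono) (auto simp: ln_div)
    also have "y * (z / y - 1) = z - y" using False by (simp add: field_simps)
    finally show ?thesis by (simp add: log_def algebra_simps)
  qed (use that in simp)
  have "(bin_entropy x - cross_entropy x q) * ln 2
    = x * (log 2 q - log 2 x) * ln 2 + (1 - x) * (log 2 (1 - q) - log 2 (1 - x)) * ln 2"
    by (simp add: bin_entropy_def cross_entropy_def algebra_simps)
  also have "\<dots> \<le> 0"
    using gibbs[of x q] gibbs[of "1 - x" "1 - q"] assms by simp
  finally show ?thesis by (simp add: mult_le_0_iff)
qed

text \<open>The slope in \<open>x\<close> has a sign determined by whether \<open>q\<close> lies
  below or above 1/2; this replaces calculus in the monotonicity arguments.\<close>

lemma cross_entropy_diff: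
  "cross_entropy x q - cross_entropy y q = (y - x) * (log 2 q - log 2 (1 - q))"
  by (simp add: cross_entropy_def algebra_simps)

text \<open>By Gibbs' inequality, \<open>cross_entropy _ z\<close> is a line above the entropy that
  touches it at \<open>z\<close>. For \<open>z > 1/2\<close> the line falls strictly, so the entropy
  to the right of \<open>z\<close> is smaller than at \<open>z\<close>.\<close>

lemma bin_entropy_strict_decreasing:
  assumes "1 / 2 \<le> x" "x < y" "y \<le> 1"
  shows "bin_entropy y < bin_entropy x"
proof -
  have less: "bin_entropy y < bin_entropy z" if "1 / 2 < z" "z < y" for z
  proof -
    have "cross_entropy y z - cross_entropy z z < 0"
      unfolding cross_entropy_diff using that assms by (intro mult_neg_pos) auto
    then show ?thesis
      using bin_entropy_le_cross_entropy[of y z] that assms by (simp add: cross_entropy_self)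
  qed
  \<comment> \<open>At \<open>x = 1/2\<close> the tangent is horizontal and yields only a weak
    inequality; strictness comes from the midpoint.\<close>
  define z where "z = (x + y) / 2"
  have z: "1 / 2 < z" "x < z" "z < y" using assms by (auto simp: z_def)
  have "cross_entropy z x - cross_entropy x x \<le> 0"
    unfolding cross_entropy_diff using z assms by (intro mult_nonpos_nonneg) auto
  then have "bin_entropy z \<le> bin_entropy x"
    using bin_entropy_le_cross_entropy[of z x] z assms by (simp add: cross_entropy_self)
  with less[OF z(1,3)] show ?thesis by simp
qed

lemma bin_entropy_le_1: "0 \<le> x \<Longrightarrow> x \<le> 1 \<Longrightarrow> bin_entropy x \<le> 1"
  using bin_entropy_le_cross_entropy[of x "1 / 2"]
  by (simp add: cross_entropy_def log_divide algebra_simps)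

lemma bin_entropy_nonneg:
  assumes "1 / 2 \<le> x" "x \<le> 1"
  shows "0 \<le> bin_entropy x"
  using bin_entropy_strict_decreasing[of x 1] assms
  by (cases "x = 1") (auto simp: bin_entropy_def)

lemma bin_entropy_flip: "bin_entropy (1 - x) = bin_entropy x"
  by (simp add: bin_entropy_def algebra_simps)

section \<open>Bins with many ones\<close>

text \<open>The free parameter \<open>x\<close> lets a one-sided bound on the weight of \<open>b\<close> be turned directly into
  a bound on its likelihood, by the sign of the second summand.\<close>

lemma P_K_eq_powr:
  assumes "b \<in> bins m" "0 < q" "q < 1"
  shows "P_K q m b =
    2 powr ((real (ones b) - x * real m) * (log 2 q - log 2 (1 - q)) - real m * cross_entropy x q)"
proof -
  have "P_K q m b = q powr real (ones b) * (1 - q) powr (real m - real (ones b))"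
    using assms ones_le[OF assms(1)] by (simp add: P_K_eq powr_realpow[symmetric] of_nat_diff)
  also have "\<dots> = 2 powr (log 2 q * real (ones b)) * 2 powr (log 2 (1 - q) * (real m - real (ones b)))"
    using assms by (simp add: powr_powr[symmetric])
  finally show ?thesis
    by (simp add: powr_add[symmetric] cross_entropy_def algebra_simps)
qed

lemma P_K_pos: "b \<in> bins m \<Longrightarrow> 0 < q \<Longrightarrow> q < 1 \<Longrightarrow> 0 < P_K q m b"
  by (simp add: P_K_eq_powr[where x = 0])

text \<open>Turning a zero into a one multiplies the likelihood by \<open>p / (1 - p) < 1\<close>.
  At \<open>p = 1/2\<close> all bins tie, hence the strict bound on \<open>p\<close>.\<close>

lemma P_K_less_iff:
  assumes "b \<in> bins m" "c \<in> bins m" "0 < p" "p < 1 / 2"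
  shows "P_K p m b < P_K p m c \<longleftrightarrow> ones c < ones b"
proof -
  have "log 2 p - log 2 (1 - p) < 0" using assms by simp
  then show ?thesis
    using assms by (simp add: P_K_eq_powr[where x = 0] mult_less_cancel_right)
qed

section \<open>Total mass, variance and concentration of the number of ones\<close>

lemma finite_bins: "finite (bins m)"
  using finite_lists_length_eq[of "UNIV :: bool set" m] by (simp add: bins_def)

lemma sum_P_K: "(\<Sum>b\<in>bins m. P_K q m b) = 1"
  unfolding P_K_def
  by (rule sum_pmf_eq_1) (auto simp: finite_bins set_replicate_pmf, auto simp: bins_def)

lemma sum_bins_Suc:
  fixes f :: "bool list \<Rightarrow> real"
  shows "(\<Sum>b\<in>bins (Suc m). f b) = (\<Sum>b\<in>bins m. f (True # b)) + (\<Sum>b\<in>bins m. f (False # b))"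
proof -
  have "bins (Suc m) = (#) True ` bins m \<union> (#) False ` bins m"
    by (auto simp: bins_def length_Suc_conv image_iff)
  then show ?thesis
    by (simp add: finite_bins) (subst sum.union_disjoint, auto simp: finite_bins sum.reindex inj_on_def)
qed

lemma P_K_Cons:
  assumes "b \<in> bins m" "0 \<le> q" "q \<le> 1"
  shows "P_K q (Suc m) (True # b) = q * P_K q m b"
    and "P_K q (Suc m) (False # b) = (1 - q) * P_K q m b"
proof -
  have "x # b \<in> bins (Suc m)" for x using assms by (simp add: bins_def)
  with assms ones_le[OF assms(1)] show "P_K q (Suc m) (True # b) = q * P_K q m b"
    and "P_K q (Suc m) (False # b) = (1 - q) * P_K q m b"
    by (simp_all add: P_K_eq Suc_diff_le)
qed

text \<open>The variance of the binomial distribution. An additional bit shifts the deviation by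
  \<open>1 - q\<close> or \<open>- q\<close>; the cross terms cancel in the mean and
  \<open>q (1 - q)\<close> is added.\<close>

lemma sum_P_K_centered_square:
  assumes "0 \<le> q" "q \<le> 1"
  shows "(\<Sum>b\<in>bins m. P_K q m b * (real (ones b) - q * real m)\<^sup>2) = real m * (q * (1 - q))"
proof (induction m)
  case (Suc m)
  have "(\<Sum>b\<in>bins (Suc m). P_K q (Suc m) b * (real (ones b) - q * real (Suc m))\<^sup>2)
    = (\<Sum>b\<in>bins m. P_K q m b * (real (ones b) - q * real m)\<^sup>2 + q * (1 - q) * P_K q m b)"
    unfolding sum_bins_Suc sum.distrib[symmetric]
    by (rule sum.cong) (auto simp: P_K_Cons assms algebra_simps power2_eq_square)
  also have "\<dots> = real m * (q * (1 - q)) + q * (1 - q)"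
    using Suc by (simp only: sum.distrib sum_distrib_left[symmetric] sum_P_K mult_1_right)
  also have "\<dots> = real (Suc m) * (q * (1 - q))"
    by (simp add: algebra_simps)
  finally show ?case .
qed (simp add: bins_def)

text \<open>Chebyshev's inequality with variance at most \<open>m\<close>: the mass outside is at
  most \<open>1 / (\<delta>^2 m)\<close>, hence at most 1/2.\<close>

lemma sum_P_K_near:
  assumes "0 \<le> q" "q \<le> 1" "0 < \<delta>" "2 / \<delta>\<^sup>2 \<le> real m" "0 < m"
  shows "1 / 2 \<le> (\<Sum>b | b \<in> bins m \<and> \<bar>real (ones b) - q * real m\<bar> \<le> \<delta> * real m. P_K q m b)"
proof -
  define N where "N = {b \<in> bins m. \<bar>real (ones b) - q * real m\<bar> \<le> \<delta> * real m}"
  have N: "N \<subseteq> bins m" by (auto simp: N_def)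
  have "(\<delta> * real m)\<^sup>2 * (\<Sum>b\<in>bins m - N. P_K q m b)
    \<le> (\<Sum>b\<in>bins m - N. P_K q m b * (real (ones b) - q * real m)\<^sup>2)"
    unfolding sum_distrib_left
  proof (rule sum_mono)
    fix b assume "b \<in> bins m - N"
    then have "\<delta> * real m \<le> \<bar>real (ones b) - q * real m\<bar>" by (auto simp: N_def)
    then have "(\<delta> * real m)\<^sup>2 \<le> (real (ones b) - q * real m)\<^sup>2"
      using assms(3) by (subst power2_abs[symmetric], intro power_mono) auto
    then show "(\<delta> * real m)\<^sup>2 * P_K q m b \<le> P_K q m b * (real (ones b) - q * real m)\<^sup>2"
      by (subst mult.commute) (intro mult_left_mono, auto simp: P_K_def)
  qed
  also have "\<dots> \<le> (\<Sum>b\<in>bins m. P_K q m b * (real (ones b) - q * real m)\<^sup>2)"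
    by (intro sum_mono2) (auto simp: finite_bins P_K_def)
  also have "\<dots> \<le> real m * (1 * 1)"
    unfolding sum_P_K_centered_square[OF assms(1,2)] using assms by (intro mult_left_mono mult_mono) auto
  also have "\<dots> \<le> (\<delta> * real m)\<^sup>2 * (1 / 2)"
    using assms mult_right_mono[OF assms(4), of "\<delta>\<^sup>2 * real m"]
    by (simp add: power2_eq_square field_simps)
  finally have "(\<Sum>b\<in>bins m - N. P_K q m b) \<le> 1 / 2"
    using assms by (subst (asm) mult_le_cancel_left_pos) auto
  moreover have "(\<Sum>b\<in>bins m - N. P_K q m b) + (\<Sum>b\<in>N. P_K q m b) = 1"
    using sum.subset_diff[OF N finite_bins, of "P_K q m"] by (simp add: sum_P_K)
  ultimately show ?thesis by (simp add: N_def)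
qed

section \<open>Sizes of the upper weight classes and sums over them\<close>

text \<open>For \<open>p < 1/2\<close> each such set is an initial segment of every likelihood
  ordering, so comparing it with the allocated bins only takes a comparison of
  cardinalities.\<close>

definition heavy :: "nat \<Rightarrow> real \<Rightarrow> bool list set" where
  "heavy m x = {b \<in> bins m. x * real m \<le> real (ones b)}"

lemma finite_heavy: "finite (heavy m x)"
  by (simp add: heavy_def finite_bins)

text \<open>For \<open>q \<ge> 1/2\<close> each of these bins has likelihood at least
  \<open>2^(-m H(q))\<close> under \<open>P_K q\<close>, and the total mass is 1.\<close>

lemma card_heavy_le:
  assumes "1 / 2 \<le> q" "q < 1"
  shows "real (card (heavy m q)) \<le> 2 powr (real m * bin_entropy q)"
proof -
  have "real (card (heavy m q)) * 2 powr - (real m * bin_entropy q)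
    = (\<Sum>b\<in>heavy m q. 2 powr - (real m * bin_entropy q))"
    by simp
  also have "\<dots> \<le> (\<Sum>b\<in>heavy m q. P_K q m b)"
    using assms
    by (intro sum_mono) (auto simp: heavy_def P_K_eq_powr[where x = q] cross_entropy_self)
  also have "\<dots> \<le> (\<Sum>b\<in>bins m. P_K q m b)"
    by (intro sum_mono2) (auto simp: finite_bins P_K_def heavy_def)
  finally show ?thesis by (simp add: sum_P_K powr_minus field_simps)
qed

text \<open>Bins whose fraction of ones is within \<open>\<delta>\<close> of \<open>q\<close> carry
  at least half of the mass of \<open>P_K q\<close>, while none of them is likelier than a string
  with fraction \<open>q + \<delta>\<close> would be at the bottom of the exponent range. The loss
  against \<open>H(q)\<close> is linear in \<open>\<delta>\<close>.\<close>

lemma card_heavy_ge: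
  assumes "1 / 2 \<le> q" "q < 1" "0 < \<delta>" "2 / \<delta>\<^sup>2 \<le> real m" "0 < m"
  shows "2 powr (real m * cross_entropy (q + \<delta>) q) / 2 \<le> real (card (heavy m (q - \<delta>)))"
proof -
  define N where "N = {b \<in> bins m. \<bar>real (ones b) - q * real m\<bar> \<le> \<delta> * real m}"
  have "1 / 2 \<le> (\<Sum>b\<in>N. P_K q m b)"
    using sum_P_K_near[of q \<delta> m] assms by (simp add: N_def)
  also have "\<dots> \<le> (\<Sum>b\<in>N. 2 powr - (real m * cross_entropy (q + \<delta>) q))"
  proof (intro sum_mono)
    fix b assume b: "b \<in> N"
    then have "real (ones b) - (q + \<delta>) * real m \<le> 0" by (auto simp: N_def algebra_simps)
    then have "(real (ones b) - (q + \<delta>) * real m) * (log 2 q - log 2 (1 - q)) \<le> 0"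
      using assms by (intro mult_nonpos_nonneg) auto
    then show "P_K q m b \<le> 2 powr - (real m * cross_entropy (q + \<delta>) q)"
      using b assms by (simp add: N_def P_K_eq_powr[where x = "q + \<delta>"])
  qed
  also have "\<dots> = real (card N) * 2 powr - (real m * cross_entropy (q + \<delta>) q)" by simp
  also have "\<dots> \<le> real (card (heavy m (q - \<delta>))) * 2 powr - (real m * cross_entropy (q + \<delta>) q)"
    by (intro mult_right_mono of_nat_mono card_mono finite_heavy)
       (auto simp: N_def heavy_def algebra_simps)
  finally show ?thesis by (simp add: powr_minus field_simps)
qed

text \<open>Tilting: weighting the bins by \<open>P_K s\<close>, the ratio \<open>1 / (P_K p * P_K s)\<close> decreases in the weight
  of the bin exactly because \<open>1 - p \<le> s\<close>.\<close>

lemma sum_heavy_inverse_P_K_le: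
  assumes "0 < p" "p < 1" "1 - p \<le> s" "s < 1"
  shows "(\<Sum>b\<in>heavy m s. 1 / P_K p m b) \<le> 2 powr (real m * (cross_entropy s p + bin_entropy s))"
proof -
  have s: "0 < s" using assms by simp
  have tilt: "0 \<le> log 2 p - log 2 (1 - p) + (log 2 s - log 2 (1 - s))"
  proof -
    have "log 2 (1 - p) \<le> log 2 s" "log 2 (1 - s) \<le> log 2 p" using assms s by auto
    then show ?thesis by simp
  qed
  have "1 / P_K p m b \<le> 2 powr (real m * (cross_entropy s p + bin_entropy s)) * P_K s m b"
    if "b \<in> heavy m s" for b
  proof -
    have b: "b \<in> bins m" "0 \<le> real (ones b) - s * real m" using that by (auto simp: heavy_def)
    have "0 \<le> (real (ones b) - s * real m) *
        (log 2 p - log 2 (1 - p) + (log 2 s - log 2 (1 - s)))"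
      using b(2) tilt by (rule mult_nonneg_nonneg)
    then have "2 powr - (real m * (cross_entropy s p + bin_entropy s)) \<le> P_K p m b * P_K s m b"
      using assms s b
      by (simp add: P_K_eq_powr[where x = s] powr_add[symmetric] cross_entropy_self algebra_simps)
    then show ?thesis
      using P_K_pos[OF b(1) assms(1,2)] by (simp only: powr_minus) (simp add: field_simps)
  qed
  then have "(\<Sum>b\<in>heavy m s. 1 / P_K p m b)
    \<le> (\<Sum>b\<in>heavy m s. 2 powr (real m * (cross_entropy s p + bin_entropy s)) * P_K s m b)"
    by (rule sum_mono)
  also have "\<dots> \<le> (\<Sum>b\<in>bins m. 2 powr (real m * (cross_entropy s p + bin_entropy s)) * P_K s m b)"
    by (intro sum_mono2) (auto simp: finite_bins P_K_def heavy_def)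
  finally show ?thesis by (simp add: sum_distrib_left[symmetric] sum_P_K)
qed

text \<open>Whatever its value, a bit contributes \<open>p (1 - p)\<close> to the product of the two
  likelihoods. Up to a constant the inverse likelihoods thus form the Bernoulli(1 - p) distribution,
  which concentrates at the fraction \<open>1 - p\<close> of ones.\<close>

lemma inverse_P_K_eq_flip:
  assumes "b \<in> bins m" "0 < p" "p < 1"
  shows "1 / P_K p m b = P_K (1 - p) m b / (p * (1 - p)) ^ m"
proof -
  have "P_K p m b * P_K (1 - p) m b = (p * (1 - p)) ^ (ones b + (m - ones b))"
    using assms by (simp only: power_add) (simp add: P_K_eq power_mult_distrib)
  then show ?thesis
    using P_K_pos[OF assms] assms ones_le[OF assms(1)] by (simp add: field_simps)
qed

section \<open>Allocated bins compared with weight classes\<close>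

lemma likelihood_ordering_bins:
  "likelihood_ordering p m b \<Longrightarrow> i \<in> {1..2 ^ m} \<Longrightarrow> b i \<in> bins m"
  by (auto simp: likelihood_ordering_def bij_betw_def)

text \<open>If \<open>b i\<close> were not heavy, every heavy bin would have more ones, be strictly
  less likely and so precede \<open>i\<close>. This leaves room for at most \<open>i - 1 < M\<close>
  heavy bins.\<close>

lemma allocated_subset_heavy:
  assumes "likelihood_ordering p m b" "0 < p" "p < 1 / 2"
    and "M \<le> card (heavy m x)" "M \<le> 2 ^ m" "i \<in> {1..M}"
  shows "b i \<in> heavy m x"
proof (rule ccontr)
  assume neg: "b i \<notin> heavy m x"
  have i: "i \<in> {1..2 ^ m}" using assms by auto
  have bij: "bij_betw b {1..2 ^ m} (bins m)"
    and mono: "\<And>j. j \<in> {1..2 ^ m} \<Longrightarrow> i \<le> j \<Longrightarrow> P_K p m (b i) \<le> P_K p m (b j)"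
    using assms(1) i by (auto simp: likelihood_ordering_def)
  have "heavy m x \<subseteq> b ` {1..<i}"
  proof
    fix c assume c: "c \<in> heavy m x"
    then have "c \<in> bins m" by (simp add: heavy_def)
    then obtain j where j: "j \<in> {1..2 ^ m}" "c = b j"
      using bij unfolding bij_betw_def by blast
    have "ones (b i) < ones c"
      using c neg likelihood_ordering_bins[OF assms(1) i] by (auto simp: heavy_def)
    then have "P_K p m (b j) < P_K p m (b i)"
      using P_K_less_iff assms(2,3) likelihood_ordering_bins[OF assms(1)] i j by blast
    then have "j < i" using mono[of j] j by (meson not_le)
    then show "c \<in> b ` {1..<i}" using j by auto
  qed
  then have "card (heavy m x) \<le> card {1..<i}"
    by (intro surj_card_le) auto
  then show False using assms(4,6) by auto
qed

text \<open>If a heavy bin had an index \<open>j > M\<close>, the bins \<open>b 1\<close> to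
  \<open>b j\<close> would all have at least as many ones, giving more than \<open>M\<close> heavy
  bins.\<close>

lemma heavy_subset_allocated:
  assumes "likelihood_ordering p m b" "0 < p" "p < 1 / 2"
    and "card (heavy m x) \<le> M" "M \<le> 2 ^ m"
  shows "heavy m x \<subseteq> b ` {1..M}"
proof (rule ccontr)
  assume "\<not> heavy m x \<subseteq> b ` {1..M}"
  then obtain c where c: "c \<in> heavy m x" "c \<notin> b ` {1..M}" by auto
  have bij: "bij_betw b {1..2 ^ m} (bins m)"
    using assms(1) by (auto simp: likelihood_ordering_def)
  obtain j where j: "j \<in> {1..2 ^ m}" "c = b j"
    using bij c unfolding bij_betw_def heavy_def by blast
  then have "M < j" using c by (metis atLeastAtMost_iff image_eqI not_le)
  have "b ` {1..j} \<subseteq> heavy m x"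
  proof
    fix d assume "d \<in> b ` {1..j}"
    then obtain i where i: "i \<in> {1..2 ^ m}" "i \<le> j" "d = b i" using j by auto
    then have "P_K p m d \<le> P_K p m c"
      using assms(1) j by (auto simp: likelihood_ordering_def)
    then have "ones c \<le> ones d"
      using P_K_less_iff[of c m d p] likelihood_ordering_bins[OF assms(1)] assms(2,3) i j by auto
    then show "d \<in> heavy m x"
      using c likelihood_ordering_bins[OF assms(1)] i by (auto simp: heavy_def)
  qed
  then have "card (b ` {1..j}) \<le> M"
    using card_mono[OF finite_heavy] assms(4) le_trans by blast
  moreover have "inj_on b {1..j}"
    using bij j by (auto simp: bij_betw_def intro: inj_on_subset)
  ultimately show False using \<open>M < j\<close> by (simp add: card_image)
qed

section \<open>Averaging over the allocated bins\<close>

text \<open>Each bit contributes at least the factor \<open>p\<close>. This makes the condition on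
  the key length uniform over all bins.\<close>

lemma p_power_le_P_K:
  assumes "c \<in> bins m" "0 < p" "p \<le> 1 / 2"
  shows "p ^ m \<le> P_K p m c"
proof -
  have "p ^ m = p ^ ones c * p ^ (m - ones c)"
    using ones_le[OF assms(1)] by (simp add: power_add[symmetric])
  also have "\<dots> \<le> P_K p m c"
    using assms by (auto simp: P_K_eq intro!: mult_left_mono power_mono)
  finally show ?thesis .
qed

lemma remote_guesswork_le:
  assumes "likelihood_ordering p m b" "guess_order n g" "0 < p" "p < 1" "M \<le> 2 ^ m"
  shows "remote_guesswork p n m g b M \<le> (\<Sum>i = 1..M. 1 / P_K p m (b i)) / real M"
  unfolding remote_guesswork_def using assms
  by (intro divide_right_mono sum_mono expectation_G_bin_le P_K_pos likelihood_ordering_bins[OF assms(1)]) auto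

lemma remote_guesswork_ge:
  assumes "likelihood_ordering p m b" "guess_order n g" "0 < p" "p \<le> 1 / 2" "M \<le> 2 ^ m"
    and "3 \<le> 2 ^ n * p ^ m"
  shows "(\<Sum>i = 1..M. 1 / P_K p m (b i)) / (2 * real M) \<le> remote_guesswork p n m g b M"
proof -
  have "1 / (2 * P_K p m (b i)) \<le>
      measure_pmf.expectation (key_pmf p n m) (\<lambda>k. real (G_bin n m g k (b i)))"
    if "i \<in> {1..M}" for i
  proof (rule expectation_G_bin_ge[OF assms(2)])
    show bins: "b i \<in> bins m"
      using that assms(5) by (intro likelihood_ordering_bins[OF assms(1)]) auto
    show "0 < P_K p m (b i)" using bins assms(3,4) by (intro P_K_pos) auto
    have "2 ^ n * p ^ m \<le> 2 ^ n * P_K p m (b i)"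
      using p_power_le_P_K[OF bins assms(3,4)] by simp
    with assms(6) show "3 \<le> 2 ^ n * P_K p m (b i)" by linarith
  qed
  then have "(\<Sum>i = 1..M. 1 / (2 * P_K p m (b i))) / real M \<le> remote_guesswork p n m g b M"
    unfolding remote_guesswork_def by (intro divide_right_mono sum_mono) auto
  moreover have "(\<Sum>i = 1..M. 1 / (2 * P_K p m (b i))) = (\<Sum>i = 1..M. 1 / P_K p m (b i)) / 2"
    by (simp add: sum_divide_distrib mult.commute)
  ultimately show ?thesis by (simp only:)
qed

lemma sum_allocated_eq:
  assumes "likelihood_ordering p m b" "M \<le> 2 ^ m"
  shows "(\<Sum>i = 1..M. f (b i)) = (\<Sum>c\<in>b ` {1..M}. f c)" and "b ` {1..M} \<subseteq> bins m"
proof -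
  have "bij_betw b {1..2 ^ m} (bins m)" "{1..M} \<subseteq> {1..2 ^ m}"
    using assms by (auto simp: likelihood_ordering_def)
  then have "inj_on b {1..M}" "b ` {1..M} \<subseteq> bins m"
    unfolding bij_betw_def by (metis inj_on_subset, blast)
  then show "(\<Sum>i = 1..M. f (b i)) = (\<Sum>c\<in>b ` {1..M}. f c)" "b ` {1..M} \<subseteq> bins m"
    by (simp_all add: sum.reindex)
qed

section \<open>Number of users, key length and exponential rates\<close>

lemma num_users_bounds:
  shows "1 \<le> num_users s m"
    and "real (num_users s m) \<le> max 1 (2 powr (bin_entropy s * real m - 1))"
    and "2 powr (bin_entropy s * real m) / 4 \<le> real (num_users s m)"
proof -
  define y where "y = 2 powr (bin_entropy s * real m - 1)"
  have y: "num_users s m = max 1 (nat \<lfloor>y\<rfloor>)" "0 < y"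
    by (simp_all add: num_users_def y_def)
  have nat: "real (nat \<lfloor>y\<rfloor>) = real_of_int \<lfloor>y\<rfloor>" using y(2) by simp
  show "1 \<le> num_users s m" by (simp add: y)
  have "real (num_users s m) = max 1 (real_of_int \<lfloor>y\<rfloor>)"
    unfolding y(1) by (simp add: of_nat_max nat)
  moreover have "y - 1 < real_of_int \<lfloor>y\<rfloor>" "real_of_int \<lfloor>y\<rfloor> \<le> y"
    by linarith+
  \<comment> \<open>For the lower bound: if \<open>y \<le> 2\<close>, then 1 is at least
    \<open>y / 2\<close>; otherwise \<open>y - 1\<close> is. The two halvings, here and in
    \<open>y\<close>, give the factor 1/4.\<close>
  ultimately have "real (num_users s m) \<le> max 1 y" and "y / 2 \<le> real (num_users s m)"
    by linarith+
  then show "real (num_users s m) \<le> max 1 (2 powr (bin_entropy s * real m - 1))"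
    and "2 powr (bin_entropy s * real m) / 4 \<le> real (num_users s m)"
    by (simp_all add: y_def powr_diff)
qed

lemma num_users_le_powr:
  assumes "0 \<le> bin_entropy s"
  shows "real (num_users s m) \<le> 2 powr (bin_entropy s * real m)"
proof -
  have "1 \<le> 2 powr (bin_entropy s * real m)"
    using assms by (intro ge_one_powr_ge_zero) auto
  moreover have "2 powr (bin_entropy s * real m - 1) \<le> 2 powr (bin_entropy s * real m)"
    by simp
  ultimately show ?thesis using num_users_bounds(2)[of s m] by linarith
qed

lemma num_users_le:
  assumes "1 / 2 \<le> s" "s \<le> 1"
  shows "num_users s m \<le> 2 ^ m"
proof -
  have "real (num_users s m) \<le> 2 powr (bin_entropy s * real m)"
    using bin_entropy_nonneg assms by (intro num_users_le_powr) auto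
  also have "\<dots> \<le> 2 powr (1 * real m)"
    using bin_entropy_le_1[of s] assms by (intro powr_mono mult_right_mono) auto
  finally have "real (num_users s m) \<le> real (2 ^ m)" by (simp add: powr_realpow)
  then show ?thesis by (simp only: of_nat_le_iff)
qed

text \<open>The surplus \<open>\<epsilon>\<close> in the key length makes \<open>2^n p^m\<close> at
  least \<open>2^(\<epsilon> m log (1/p))\<close>, which is at least 4 as soon as this exponent
  reaches 2.\<close>

lemma eventually_key_long:
  fixes n :: "nat \<Rightarrow> nat"
  assumes "0 < p" "p < 1" "0 < \<epsilon>"
    and "\<And>m. (1 + \<epsilon>) * real m * log 2 (1 / p) \<le> real (n m)"
  shows "\<forall>\<^sub>F m in sequentially. 3 \<le> 2 ^ n m * p ^ m"
proof -
  have L: "0 < log 2 (1 / p)" using assms by simp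
  have "\<forall>\<^sub>F m in sequentially. 2 / (\<epsilon> * log 2 (1 / p)) \<le> real m"
    by (intro eventually_ge_at_top[THEN eventually_compose_filterlim] filterlim_real_sequentially)
  then show ?thesis
  proof eventually_elim
    case (elim m)
    then have "2 \<le> \<epsilon> * real m * log 2 (1 / p)"
      using L assms by (simp add: field_simps)
    also have "\<dots> \<le> real (n m) - real m * log 2 (1 / p)"
      using assms(4)[of m] by (simp add: algebra_simps)
    finally have "2 powr 2 \<le> 2 powr (real (n m) - real m * log 2 (1 / p))"
      by (intro powr_mono) auto
    also have "\<dots> = 2 powr real (n m) * (2 powr log 2 p) powr real m"
      using assms by (simp add: powr_powr powr_add[symmetric] log_divide algebra_simps del: powr_log_cancel)
    also have "\<dots> = 2 ^ n m * p ^ m"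
      using assms by (simp add: powr_realpow)
    finally show ?case by simp
  qed
qed

text \<open>Constant factors vanish in the limit because \<open>log c / m\<close> tends to 0. Lower
  bounds are only asked for exponents \<open>r < a\<close>, which leaves slack for approximating the
  boundary weight.\<close>

lemma exponential_rate:
  fixes R :: "nat \<Rightarrow> real"
  assumes "0 < C" "\<forall>\<^sub>F m in sequentially. R m \<le> C * 2 powr (real m * a)"
    and "\<And>r. r < a \<Longrightarrow> \<exists>c>0. \<forall>\<^sub>F m in sequentially. c * 2 powr (real m * r) \<le> R m"
  shows "(\<lambda>m. 1 / real m * log 2 (R m)) \<longlonglongrightarrow> a"
proof -
  have log_eq: "1 / real m * log 2 (c * 2 powr (real m * r)) = log 2 c / real m + r"
    if "0 < c" "0 < m" for c r m
    using that by (simp add: log_mult field_simps)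
  have lim: "(\<lambda>m. log 2 c / real m + r) \<longlonglongrightarrow> r" for c r
    by (rule tendsto_eq_intros lim_const_over_n refl | simp)+
  \<comment> \<open>Any lower bound serves here: it makes \<open>R m\<close> eventually positive, so
    that the logarithm is monotone in the upper estimate.\<close>
  obtain c0 where c0: "0 < c0" "\<forall>\<^sub>F m in sequentially. c0 * 2 powr (real m * (a - 1)) \<le> R m"
    using assms(3)[of "a - 1"] by auto
  show ?thesis
  proof (rule order_tendstoI)
    fix y assume "y < a"
    define r where "r = (y + a) / 2"
    have r: "y < r" "r < a" using \<open>y < a\<close> by (auto simp: r_def)
    then obtain c where c: "0 < c" "\<forall>\<^sub>F m in sequentially. c * 2 powr (real m * r) \<le> R m"
      using assms(3) by blast
    show "\<forall>\<^sub>F m in sequentially. y < 1 / real m * log 2 (R m)"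
      using c(2) order_tendstoD(1)[OF lim[of c r] r(1)] eventually_gt_at_top[of 0]
    proof eventually_elim
      case (elim m)
      have "log 2 (c * 2 powr (real m * r)) \<le> log 2 (R m)"
        using elim(1) c(1) by (intro log_mono) auto
      then have "1 / real m * log 2 (c * 2 powr (real m * r)) \<le> 1 / real m * log 2 (R m)"
        by (intro mult_left_mono) auto
      then show ?case using elim(2) log_eq[OF c(1) elim(3), of r] by linarith
    qed
  next
    fix y assume "a < y"
    show "\<forall>\<^sub>F m in sequentially. 1 / real m * log 2 (R m) < y"
      using assms(2) c0(2) order_tendstoD(2)[OF lim[of C a] \<open>a < y\<close>] eventually_gt_at_top[of 0]
    proof eventually_elim
      case (elim m)
      have "0 < c0 * 2 powr (real m * (a - 1))" using c0(1) by simp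
      then have "log 2 (R m) \<le> log 2 (C * 2 powr (real m * a))"
        using elim(1,2) by (intro log_mono) auto
      then have "1 / real m * log 2 (R m) \<le> 1 / real m * log 2 (C * 2 powr (real m * a))"
        by (intro mult_left_mono) auto
      then show ?case using elim(3) log_eq[OF assms(1) elim(4), of a] by linarith
    qed
  qed
qed

section \<open>Sums of inverse likelihoods over the allocated bins\<close>

lemma inverse_P_K_ge:
  assumes "b \<in> heavy m x" "0 < p" "p \<le> 1 / 2"
  shows "2 powr (real m * cross_entropy x p) \<le> 1 / P_K p m b"
proof -
  have b: "b \<in> bins m" "0 \<le> real (ones b) - x * real m" using assms(1) by (auto simp: heavy_def)
  have "(real (ones b) - x * real m) * (log 2 p - log 2 (1 - p)) \<le> 0"
    using b assms by (intro mult_nonneg_nonpos) auto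
  then have "P_K p m b \<le> 2 powr - (real m * cross_entropy x p)"
    using b assms by (simp add: P_K_eq_powr[where x = x])
  then show ?thesis
    using P_K_pos[of b m p] b assms by (simp only: powr_minus) (simp add: field_simps)
qed

lemma inverse_P_K_le:
  assumes "b \<in> bins m" "real (ones b) \<le> x * real m" "0 < p" "p \<le> 1 / 2"
  shows "1 / P_K p m b \<le> 2 powr (real m * cross_entropy x p)"
proof -
  have "0 \<le> (real (ones b) - x * real m) * (log 2 p - log 2 (1 - p))"
    using assms by (intro mult_nonpos_nonpos) auto
  then have "2 powr - (real m * cross_entropy x p) \<le> P_K p m b"
    using assms by (simp add: P_K_eq_powr[where x = x])
  then show ?thesis
    using P_K_pos[of b m p] assms by (simp only: powr_minus) (simp add: field_simps)
qed

text \<open>With \<open>T = 2^(m cross_entropy s p)\<close>, a bin with fewer than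
  \<open>s m\<close> ones contributes at most \<open>T\<close>. All others together contribute at
  most \<open>T 2^(m H(s))\<close> by tilting, which is at most \<open>4 M T\<close>; hence the
  factor 5.\<close>

lemma allocated_sum_le:
  assumes "likelihood_ordering p m b" "M \<le> 2 ^ m" "0 < p" "p \<le> 1 / 2" "1 - p \<le> s" "s \<le> 1"
    and "2 powr (bin_entropy s * real m) / 4 \<le> real M"
  shows "(\<Sum>i = 1..M. 1 / P_K p m (b i)) \<le> real M * (5 * 2 powr (real m * cross_entropy s p))"
proof -
  let ?T = "2 powr (real m * cross_entropy s p)"
  have bins: "b i \<in> bins m" if "i \<in> {1..M}" for i
    using sum_allocated_eq(2)[OF assms(1,2)] that by blast
  show ?thesis
  proof (cases "s = 1")
    \<comment> \<open>Tilting is stated for \<open>s < 1\<close>; at \<open>s = 1\<close> no bin has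
      more than \<open>s m\<close> ones, so the bound for single bins suffices.\<close>
    case True
    have "1 / P_K p m (b i) \<le> 5 * ?T" if "i \<in> {1..M}" for i
    proof -
      have "1 / P_K p m (b i) \<le> ?T"
        using bins[OF that] ones_le True assms by (intro inverse_P_K_le) auto
      also have "\<dots> \<le> 5 * ?T" by simp
      finally show ?thesis .
    qed
    then show ?thesis
      using sum_bounded_above[of "{1..M}" "\<lambda>i. 1 / P_K p m (b i)" "5 * ?T"] by simp
  next
    case False
    let ?h = "\<lambda>c. if c \<in> heavy m s then 1 / P_K p m c else 0"
    have "1 / P_K p m (b i) \<le> ?T + ?h (b i)" if "i \<in> {1..M}" for i
      using inverse_P_K_le[OF bins[OF that], of s p] bins[OF that] assms by (auto simp: heavy_def)
    then have "(\<Sum>i = 1..M. 1 / P_K p m (b i)) \<le> (\<Sum>i = 1..M. ?T + ?h (b i))"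
      by (rule sum_mono)
    also have "\<dots> = real M * ?T + (\<Sum>c\<in>b ` {1..M}. ?h c)"
      using sum_allocated_eq(1)[OF assms(1,2), of ?h] by (simp add: sum.distrib)
    also have "(\<Sum>c\<in>b ` {1..M}. ?h c) \<le> (\<Sum>c\<in>bins m. ?h c)"
      using sum_allocated_eq(2)[OF assms(1,2)]
      by (intro sum_mono2) (auto simp: finite_bins P_K_def)
    also have "\<dots> = (\<Sum>c\<in>heavy m s. 1 / P_K p m c)"
      by (rule sum.mono_neutral_cong_right) (auto simp: finite_bins heavy_def)
    also have "\<dots> \<le> 2 powr (real m * (cross_entropy s p + bin_entropy s))"
      using False assms by (intro sum_heavy_inverse_P_K_le) auto
    also have "\<dots> = ?T * 2 powr (bin_entropy s * real m)"
      by (simp add: powr_add[symmetric] algebra_simps)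
    also have "\<dots> \<le> ?T * (4 * real M)"
      using assms(7) by (intro mult_left_mono) auto
    finally show ?thesis by (simp add: algebra_simps)
  qed
qed

lemma sum_inverse_P_K:
  assumes "0 < p" "p < 1"
  shows "(\<Sum>c\<in>bins m. 1 / P_K p m c) = 1 / (p * (1 - p)) ^ m"
proof -
  have "(\<Sum>c\<in>bins m. 1 / P_K p m c) = (\<Sum>c\<in>bins m. P_K (1 - p) m c / (p * (1 - p)) ^ m)"
    using assms by (intro sum.cong inverse_P_K_eq_flip) auto
  then show ?thesis by (simp add: sum_divide_distrib[symmetric] sum_P_K)
qed

lemma inverse_power_eq_powr:
  assumes "0 < p" "p < 1"
  shows "1 / (p * (1 - p)) ^ m = 2 powr (real m * (- log 2 p - log 2 (1 - p)))"
proof -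
  have "2 powr (real m * (- log 2 p - log 2 (1 - p))) = 2 powr (- (log 2 (p * (1 - p)) * real m))"
    using assms by (simp add: log_mult del: right_diff_distrib') (simp add: algebra_simps)
  also have "\<dots> = 1 / (2 powr log 2 (p * (1 - p))) powr real m"
    by (simp only: powr_powr powr_minus inverse_eq_divide)
  finally show ?thesis using assms by (simp add: powr_realpow)
qed

lemma eventually_le_real_mult:
  fixes a c :: real
  assumes "0 < a"
  shows "\<forall>\<^sub>F m in sequentially. c \<le> real m * a"
proof -
  have "\<forall>\<^sub>F m in sequentially. c / a \<le> real m"
    by (intro eventually_ge_at_top[THEN eventually_compose_filterlim] filterlim_real_sequentially)
  then show ?thesis using assms by (simp add: field_simps)
qed

text \<open>The tangent to the entropy at \<open>q\<close> falls and stays above the entropy, so at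
  \<open>q + \<delta> < s\<close> it exceeds \<open>H(s)\<close>. The lower bound on the size of
  \<open>heavy m (q - \<delta>)\<close> therefore outgrows the number of users.\<close>

lemma eventually_num_users_le_card_heavy:
  assumes "1 / 2 < x" "x < s" "s \<le> 1"
  shows "\<forall>\<^sub>F m in sequentially. num_users s m \<le> card (heavy m x)"
proof -
  \<comment> \<open>Thirds place \<open>q - \<delta> = x\<close>, \<open>q\<close> and
    \<open>q + \<delta>\<close> at equal distances, with one more step left before
    \<open>s\<close>.\<close>
  define \<delta> where "\<delta> = (s - x) / 3"
  define q where "q = x + \<delta>"
  have q: "0 < \<delta>" "1 / 2 < q" "q + \<delta> < s" "q < 1" "x = q - \<delta>"
    using assms by (auto simp: q_def \<delta>_def field_simps)
  have "0 < cross_entropy (q + \<delta>) q - cross_entropy s q"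
    unfolding cross_entropy_diff using q by (intro mult_pos_pos) auto
  then have H: "bin_entropy s < cross_entropy (q + \<delta>) q"
    using bin_entropy_le_cross_entropy[of s q] q assms by simp
  \<comment> \<open>Positivity lets the bound also pass the value 1 that \<open>num_users\<close>
    takes as a minimum, which matters at \<open>s = 1\<close> where \<open>H(s) = 0\<close>.\<close>
  then have pos: "0 < cross_entropy (q + \<delta>) q"
    using bin_entropy_nonneg[of s] assms by simp
  have "\<forall>\<^sub>F m in sequentially. 2 / \<delta>\<^sup>2 \<le> real m * 1"
    by (rule eventually_le_real_mult) simp
  with eventually_le_real_mult[OF pos, of 1] eventually_gt_at_top[of 0] show ?thesis
  proof eventually_elim
    case (elim m)
    have "2 powr 1 \<le> 2 powr (real m * cross_entropy (q + \<delta>) q)"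
      using elim(1) by (intro powr_mono) auto
    moreover have "2 powr (bin_entropy s * real m) \<le> 2 powr (real m * cross_entropy (q + \<delta>) q)"
      using H by (subst mult.commute, intro powr_mono mult_left_mono) auto
    ultimately have "max 1 (2 powr (bin_entropy s * real m - 1))
      \<le> 2 powr (real m * cross_entropy (q + \<delta>) q) / 2"
      by (simp add: powr_diff max_def)
    also have "\<dots> \<le> real (card (heavy m x))"
      unfolding q(5) using q elim by (intro card_heavy_ge) auto
    finally have "real (num_users s m) \<le> real (card (heavy m x))"
      using num_users_bounds(2)[of s m] by linarith
    then show ?case by simp
  qed
qed

lemma eventually_card_heavy_le_num_users:
  assumes "1 / 2 \<le> s" "s < q" "q < 1"
  shows "\<forall>\<^sub>F m in sequentially. card (heavy m q) \<le> num_users s m"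
proof -
  have "0 < bin_entropy s - bin_entropy q"
    using bin_entropy_strict_decreasing[of s q] assms by simp
  \<comment> \<open>An exponent gap of 2 absorbs the factor 1/4 in the lower bound on the number of
    users.\<close>
  from eventually_le_real_mult[OF this, of 2] show ?thesis
  proof eventually_elim
    case (elim m)
    have "real (card (heavy m q)) \<le> 2 powr (real m * bin_entropy q)"
      using assms by (intro card_heavy_le) auto
    also have "\<dots> \<le> 2 powr (bin_entropy s * real m - 2)"
      using elim by (intro powr_mono) (auto simp: algebra_simps)
    also have "\<dots> = 2 powr (bin_entropy s * real m) / 4"
      by (simp add: powr_diff)
    finally have "real (card (heavy m q)) \<le> real (num_users s m)"
      using num_users_bounds(3)[of s m] by linarith
    then show ?case by simp
  qed
qed

text \<open>For \<open>p < 1/2\<close> and any fraction \<open>x < s\<close> above 1/2, eventually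
  every allocated bin has at least \<open>x m\<close> ones. As \<open>cross_entropy _ p\<close> is
  continuous, \<open>x\<close> close to \<open>s\<close> loses less than the slack left by
  \<open>r\<close>.\<close>

lemma eventually_inverse_P_K_allocated_ge:
  assumes "0 < p" "p \<le> 1 / 2" "1 - p \<le> s" "s \<le> 1" "r < cross_entropy s p"
    and "\<And>m. likelihood_ordering p m (b m)"
  shows "\<forall>\<^sub>F m in sequentially. \<forall>i\<in>{1..num_users s m}. 2 powr (real m * r) \<le> 1 / P_K p m (b m i)"
proof (cases "p = 1 / 2")
  \<comment> \<open>All bins are equally likely here, so the ordering carries no information on
    weights, but the inverse likelihood is already the required power.\<close>
  case True
  have "2 powr (real m * r) \<le> 1 / P_K p m (b m i)" if "i \<in> {1..num_users s m}" for m i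
  proof -
    have "b m i \<in> bins m"
      using sum_allocated_eq(2)[OF assms(6) num_users_le, of s m] assms that by auto
    then have "P_K p m (b m i) = 2 powr - (real m * cross_entropy s p)"
      by (simp add: True P_K_eq_powr[where x = s])
    then have "1 / P_K p m (b m i) = 2 powr (real m * cross_entropy s p)"
      by (simp add: powr_minus_divide)
    moreover have "2 powr (real m * r) \<le> 2 powr (real m * cross_entropy s p)"
      using assms(5) by (intro powr_mono mult_left_mono) auto
    ultimately show ?thesis by simp
  qed
  then show ?thesis by simp
next
  case False
  then have p: "p < 1 / 2" using assms by simp
  define \<alpha> where "\<alpha> = log 2 (1 - p) - log 2 p"
  have \<alpha>: "0 < \<alpha>" using p assms by (simp add: \<alpha>_def)
  \<comment> \<open>The second argument keeps the loss \<open>(s - x) * \<alpha>\<close> in the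
    exponent within the slack; the first keeps \<open>x\<close> above 1/2.\<close>
  define x where "x = max ((1 / 2 + s) / 2) (s - (cross_entropy s p - r) / \<alpha>)"
  have x: "1 / 2 < x" "x < s"
    using \<alpha> p assms by (auto simp: x_def less_max_iff_disj)
  have "s - x \<le> (cross_entropy s p - r) / \<alpha>" by (auto simp: x_def)
  then have "(s - x) * \<alpha> \<le> cross_entropy s p - r" using \<alpha> by (simp add: field_simps)
  moreover have "cross_entropy s p - cross_entropy x p = (s - x) * \<alpha>"
    unfolding cross_entropy_diff by (simp add: \<alpha>_def algebra_simps)
  ultimately have r: "r \<le> cross_entropy x p" by simp
  from eventually_num_users_le_card_heavy[OF x assms(4)] show ?thesis
  proof eventually_elim
    case (elim m)
    show ?case
    proof
      fix i assume i: "i \<in> {1..num_users s m}"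
      have "b m i \<in> heavy m x"
        using allocated_subset_heavy[OF assms(6,1) p elim num_users_le i] assms by simp
      then have "2 powr (real m * cross_entropy x p) \<le> 1 / P_K p m (b m i)"
        using assms by (intro inverse_P_K_ge) auto
      moreover have "2 powr (real m * r) \<le> 2 powr (real m * cross_entropy x p)"
        using r by (intro powr_mono mult_left_mono) auto
      ultimately show "2 powr (real m * r) \<le> 1 / P_K p m (b m i)" by linarith
    qed
  qed
qed

text \<open>After the flip to \<open>P_K (1 - p)\<close> the sum is the mass of the allocated bins,
  up to the constant. As \<open>s < 1 - p\<close>, these eventually contain all bins near the
  typical fraction \<open>1 - p\<close> and hence at least half of the mass.\<close>

lemma eventually_sum_allocated_ge:
  assumes "0 < p" "p \<le> 1 / 2" "1 / 2 \<le> s" "s < 1 - p"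
    and "\<And>m. likelihood_ordering p m (b m)"
  shows "\<forall>\<^sub>F m in sequentially.
    1 / (p * (1 - p)) ^ m / 2 \<le> (\<Sum>i = 1..num_users s m. 1 / P_K p m (b m i))"
proof -
  \<comment> \<open>Strictly above \<open>s\<close>, so that \<open>heavy m q\<close> is eventually
    allocated, and strictly below \<open>1 - p\<close>, so that it contains the bins within
    \<open>\<delta>\<close> of \<open>1 - p\<close>.\<close>
  define q where "q = (s + (1 - p)) / 2"
  define \<delta> where "\<delta> = (1 - p) - q"
  have q: "s < q" "q < 1" "0 < \<delta>" and p: "p < 1 / 2"
    using assms by (auto simp: q_def \<delta>_def field_simps)
  have "\<forall>\<^sub>F m in sequentially. 2 / \<delta>\<^sup>2 \<le> real m * 1"
    by (rule eventually_le_real_mult) simp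
  with eventually_card_heavy_le_num_users[OF assms(3) q(1,2)] eventually_gt_at_top[of 0] show ?thesis
  proof eventually_elim
    case (elim m)
    have le: "num_users s m \<le> 2 ^ m" using assms by (intro num_users_le) auto
    have "heavy m q \<subseteq> b m ` {1..num_users s m}"
      using assms p by (intro heavy_subset_allocated elim le) auto
    have "1 / 2 \<le> (\<Sum>b | b \<in> bins m \<and> \<bar>real (ones b) - (1 - p) * real m\<bar> \<le> \<delta> * real m. P_K (1 - p) m b)"
      using assms q elim by (intro sum_P_K_near) auto
    also have "\<dots> \<le> (\<Sum>c\<in>heavy m q. P_K (1 - p) m c)"
      by (intro sum_mono2 finite_heavy) (auto simp: heavy_def \<delta>_def P_K_def algebra_simps)
    also have "\<dots> \<le> (\<Sum>c\<in>b m ` {1..num_users s m}. P_K (1 - p) m c)"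
      using \<open>heavy m q \<subseteq> _\<close> by (intro sum_mono2) (auto simp: P_K_def)
    finally have "1 / 2 / (p * (1 - p)) ^ m
      \<le> (\<Sum>c\<in>b m ` {1..num_users s m}. P_K (1 - p) m c) / (p * (1 - p)) ^ m"
      using assms by (intro divide_right_mono) auto
    also have "\<dots> = (\<Sum>c\<in>b m ` {1..num_users s m}. 1 / P_K p m c)"
      unfolding sum_divide_distrib using assms sum_allocated_eq(2)[OF assms(5) le]
      by (intro sum.cong inverse_P_K_eq_flip[symmetric]) auto
    also have "\<dots> = (\<Sum>i = 1..num_users s m. 1 / P_K p m (b m i))"
      by (rule sum_allocated_eq(1)[OF assms(5) le, symmetric])
    finally show ?case by (simp add: mult.commute)
  qed
qed

section \<open>The exponent of the average guesswork in both regimes\<close>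

theorem theorem10:
  fixes p s \<epsilon>\<^sub>1 :: real
    and n :: "nat \<Rightarrow> nat"
    and b :: "nat \<Rightarrow> nat \<Rightarrow> bool list"
    and g :: "nat \<Rightarrow> nat \<Rightarrow> nat"
  assumes "0 < p" "p \<le> 1 / 2"
    and "1 / 2 \<le> s" "s \<le> 1"
    and "\<epsilon>\<^sub>1 > 0"
    and "\<And>m. real (n m) \<ge> (1 + \<epsilon>\<^sub>1) * real m * log 2 (1 / p)"
    and "\<And>m. likelihood_ordering p m (b m)"
    and "\<And>m. guess_order (n m) (g m)"
  defines "rate \<equiv>
    (\<lambda>m. 1 / real m * log 2 (remote_guesswork p (n m) m (g m) (b m) (num_users s m)))"
  shows "(1 - p \<le> s \<longrightarrow> rate \<longlonglongrightarrow> bin_entropy s + bin_divergence s p) \<and>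
    (s \<le> 1 - p \<longrightarrow>
       rate \<longlonglongrightarrow> 2 * bin_entropy p + bin_divergence (1 - p) p - bin_entropy s)"
proof -
  define R where "R = (\<lambda>m. remote_guesswork p (n m) m (g m) (b m) (num_users s m))"
  have rate_eq: "rate = (\<lambda>m. 1 / real m * log 2 (R m))"
    by (simp add: rate_def R_def)
  define S where "S = (\<lambda>m. \<Sum>i = 1..num_users s m. 1 / P_K p m (b m i))"
  have p: "p < 1" using assms by simp
  have le: "num_users s m \<le> 2 ^ m" for m using assms by (intro num_users_le) auto
  have pos: "0 < real (num_users s m)" for m using num_users_bounds(1)[of s m] by simp
  have upper: "R m \<le> S m / real (num_users s m)" for m
    unfolding R_def S_def using assms p le by (intro remote_guesswork_le) auto
  have lower: "\<forall>\<^sub>F m in sequentially. S m / (2 * real (num_users s m)) \<le> R m"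
    using eventually_key_long[OF assms(1) p assms(5,6)]
    unfolding R_def S_def
    by eventually_elim (rule remote_guesswork_ge[OF assms(7,8,1,2) le])
  have case1: "rate \<longlonglongrightarrow> cross_entropy s p" if s: "1 - p \<le> s"
    unfolding rate_eq
  proof (rule exponential_rate[where C = 5])
    have "R m \<le> 5 * 2 powr (real m * cross_entropy s p)" for m
    proof -
      have "S m \<le> real (num_users s m) * (5 * 2 powr (real m * cross_entropy s p))"
        unfolding S_def using assms s le num_users_bounds(3) by (intro allocated_sum_le) auto
      then have "S m / real (num_users s m) \<le> 5 * 2 powr (real m * cross_entropy s p)"
        using pos[of m] by (simp add: field_simps)
      with upper[of m] show ?thesis by linarith
    qed
    then show "\<forall>\<^sub>F m in sequentially. R m \<le> 5 * 2 powr (real m * cross_entropy s p)" by simp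
  next
    fix r assume "r < cross_entropy s p"
    from eventually_inverse_P_K_allocated_ge[OF assms(1,2) s assms(4) this assms(7)] lower
    have "\<forall>\<^sub>F m in sequentially. 1 / 2 * 2 powr (real m * r) \<le> R m"
    proof eventually_elim
      case (elim m)
      have "real (num_users s m) * 2 powr (real m * r) \<le> S m"
        using sum_bounded_below[of "{1..num_users s m}" "2 powr (real m * r)"] elim(1)
        by (simp add: S_def)
      then have "1 / 2 * 2 powr (real m * r) \<le> S m / (2 * real (num_users s m))"
        using pos[of m] by (simp add: field_simps)
      with elim(2) show ?case by linarith
    qed
    then show "\<exists>c>0. \<forall>\<^sub>F m in sequentially. c * 2 powr (real m * r) \<le> R m"
      by (intro exI[of _ "1 / 2"]) simp
  qed simp
  \<comment> \<open>The exponent of \<open>1 / (p * (1 - p))^m\<close>, the sum of the inverse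
    likelihoods over all bins.\<close>
  define K where "K = - log 2 p - log 2 (1 - p)"
  have case2: "rate \<longlonglongrightarrow> K - bin_entropy s" if s: "s < 1 - p"
    unfolding rate_eq
  proof (rule exponential_rate[where C = 4])
    have "R m \<le> 4 * 2 powr (real m * (K - bin_entropy s))" for m
    proof -
      have "S m = (\<Sum>c\<in>b m ` {1..num_users s m}. 1 / P_K p m c)"
        unfolding S_def by (rule sum_allocated_eq(1)[OF assms(7) le])
      also have "\<dots> \<le> (\<Sum>c\<in>bins m. 1 / P_K p m c)"
        using sum_allocated_eq(2)[OF assms(7) le]
        by (intro sum_mono2) (auto simp: finite_bins P_K_def)
      also have "\<dots> = 2 powr (real m * K)"
        unfolding K_def sum_inverse_P_K[OF assms(1) p] by (rule inverse_power_eq_powr[OF assms(1) p])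
      finally have "S m / real (num_users s m)
          \<le> 2 powr (real m * K) / (2 powr (bin_entropy s * real m) / 4)"
        using num_users_bounds(3)[of s m] by (intro frac_le) auto
      also have "\<dots> = 4 * 2 powr (real m * (K - bin_entropy s))"
        by (simp add: powr_diff algebra_simps)
      finally show ?thesis using upper[of m] by linarith
    qed
    then show "\<forall>\<^sub>F m in sequentially. R m \<le> 4 * 2 powr (real m * (K - bin_entropy s))" by simp
  next
    fix r assume r: "r < K - bin_entropy s"
    from eventually_sum_allocated_ge[OF assms(1-3) s assms(7)] lower
    \<comment> \<open>One factor 1/2 is the share of the allocated bins in the full sum, the other
      the loss in the guesswork of a single bin.\<close>
    have "\<forall>\<^sub>F m in sequentially. 1 / 4 * 2 powr (real m * r) \<le> R m"
    proof eventually_elim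
      case (elim m)
      have "2 powr (real m * r) \<le> 2 powr (real m * (K - bin_entropy s))"
        using r by (intro powr_mono mult_left_mono) auto
      also have "\<dots> = 2 powr (real m * K) / 2 powr (bin_entropy s * real m)"
        by (simp add: powr_diff algebra_simps)
      also have "\<dots> \<le> 2 powr (real m * K) / real (num_users s m)"
        using assms pos[of m] by (intro divide_left_mono num_users_le_powr bin_entropy_nonneg) auto
      finally have "1 / 4 * 2 powr (real m * r)
          \<le> 2 powr (real m * K) / 2 / (2 * real (num_users s m))" by simp
      also have "\<dots> \<le> S m / (2 * real (num_users s m))"
        using elim(1) pos[of m] inverse_power_eq_powr[OF assms(1) p, of m]
        by (intro divide_right_mono) (auto simp: S_def K_def)
      finally show ?case using elim(2) by linarith
    qed
    then show "\<exists>c>0. \<forall>\<^sub>F m in sequentially. c * 2 powr (real m * r) \<le> R m"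
      by (intro exI[of _ "1 / 4"]) simp
  qed simp
  have "cross_entropy s p = bin_entropy s + bin_divergence s p"
    using assms p by (intro cross_entropy_eq_entropy_divergence) auto
  moreover have "2 * bin_entropy p + bin_divergence (1 - p) p = K"
  proof -
    have "bin_entropy p + bin_divergence (1 - p) p = cross_entropy (1 - p) p"
      using assms p by (simp add: cross_entropy_eq_entropy_divergence bin_entropy_flip)
    then show ?thesis by (simp add: K_def cross_entropy_def bin_entropy_def algebra_simps)
  qed
  \<comment> \<open>The two formulas agree at \<open>s = 1 - p\<close>, so the boundary of the
    second regime is covered by the first.\<close>
  moreover have "cross_entropy (1 - p) p = K - bin_entropy (1 - p)"
    by (simp add: K_def cross_entropy_def bin_entropy_def algebra_simps)
  ultimately show ?thesis
    using case1 case2 by (cases "s = 1 - p") auto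
qed

end
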